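(* Let $n\geq 2$ be an integer and let $F$ be a field with $\operatorname{char}(F)=2$ that carries a discrete rank $n$ valuation. Then there exist $2^n-1$ quadratic $n$-fold Pfister forms over $F$ with no common quadratic inseparable splitting field, i.e. there is no inseparable quadratic field extension $K/F$ that is a splitting field of all of these forms.
   Context: Let $F$ be a field of characteristic 2. For $\alpha,\beta\in F$, $[\alpha,\beta]$ denotes the quadratic form $(u,v)\mapsto \alpha u^2+uv+\beta v^2$. A quadratic 1-fold Pfister form is $\langle\langle \alpha]]=[1,\alpha]$ with $\alpha\in F$. For $n\geq 2$, $\beta_1,\dots,\beta_{n-1}\in F^\times$ and $\alpha\in F$, the quadratic $n$-fold Pfister form $\langle\langle \beta_1,\dots,\beta_{n-1},\alpha]]$ is $\langle\langle\beta_1,\dots,\beta_{n-1}\rangle\rangle_b\otimes[1,\alpha]$, where $\langle\langle\beta_1,\dots,\beta_{n-1}\rangle\rangle_b=\langle 1,\beta_1\rangle_b\otimes\cdots\otimes\langle 1,\beta_{n-1}\rangle_b$ is a diagonal symmetric bilinear form and $\langle c_1,\dots,c_k\rangle_b\otimes\varphi=c_1\varphi\perp\cdots\perp c_k\varphi$. A quadratic Pfister form is isotropic if and only if it is hyperbolic. A field extension $K/F$ is a splitting field of a quadratic Pfister form $\varphi$ over $F$ if the scalar extension $\varphi_K$ is isotropic (equivalently, hyperbolic). An inseparable quadratic extension of $F$ is a field $K=F[\sqrt{\gamma}]$ with $\gamma\in F^\times\setminus (F^\times)^2$. A discrete rank $n$ valuation on $F$ is a (Krull) valuation on $F$ of rank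 $n$ whose value group is $\Gamma\cong\mathbb{Z}^{n}$ (ordered lexicographically). *)

theory Defs
  imports
    "HOL-Algebra.Algebraic_Closure_Type"
    "Jordan_Normal_Form.Matrix"
begin

section \<open>Quadratic forms\<close>

text \<open>A square matrix \<open>A\<close> (not assumed symmetric) represents the quadratic form
  \<open>x \<mapsto> x\<^sup>T A x\<close>, that is, the form with coefficient \<open>A\<^sub>i\<^sub>j + A\<^sub>j\<^sub>i\<close> at \<open>x\<^sub>i x\<^sub>j\<close> for \<open>i < j\<close>.
  All forms built below are given by upper triangular matrices, which are in
  bijection with quadratic forms, also in characteristic 2.\<close>

definition qf_eval :: "'a :: comm_semiring_0 mat \<Rightarrow> 'a vec \<Rightarrow> 'a" where
  "qf_eval A x = x \<bullet> (A *\<^sub>v x)"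

definition binary_form :: "'a :: field \<Rightarrow> 'a \<Rightarrow> 'a mat" where
  "binary_form \<alpha> \<beta> = mat_of_rows_list 2 [[\<alpha>, 1], [0, \<beta>]]"

lemma qf_eval_binary_form:
  "qf_eval (binary_form \<alpha> \<beta>) (vec_of_list [u, w]) = \<alpha> * u\<^sup>2 + u * w + \<beta> * w\<^sup>2"
  by (simp add: qf_eval_def binary_form_def mat_of_rows_list_def scalar_prod_def
      mult_mat_vec_def numeral_2_eq_2 power2_eq_square algebra_simps)

text \<open>A diagonal symmetric bilinear form is represented by the list of its diagonal entries.\<close>

definition diag_tensor :: "'a :: field list \<Rightarrow> 'a list \<Rightarrow> 'a list" where
  "diag_tensor cs ds = [c * d. c \<leftarrow> cs, d \<leftarrow> ds]"

fun bilinear_pfister :: "'a :: field list \<Rightarrow> 'a list" where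
  "bilinear_pfister [] = [1]"
| "bilinear_pfister (\<beta> # \<beta>s) = diag_tensor [1, \<beta>] (bilinear_pfister \<beta>s)"

definition diag_tensor_qf :: "'a :: field list \<Rightarrow> 'a mat \<Rightarrow> 'a mat" where
  "diag_tensor_qf cs A = diag_block_mat [c \<cdot>\<^sub>m A. c \<leftarrow> cs]"

definition quadratic_pfister :: "'a :: field list \<Rightarrow> 'a \<Rightarrow> 'a mat" where
  "quadratic_pfister \<beta>s \<alpha> = diag_tensor_qf (bilinear_pfister \<beta>s) (binary_form 1 \<alpha>)"

definition is_quadratic_pfister :: "nat \<Rightarrow> 'a :: field mat \<Rightarrow> bool" where
  "is_quadratic_pfister n A \<longleftrightarrow>
     (\<exists>\<beta>s \<alpha>. length \<beta>s + 1 = n \<and> 0 \<notin> set \<beta>s \<and> A = quadratic_pfister \<beta>s \<alpha>)"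


section \<open>Inseparable quadratic extensions and splitting fields\<close>

text \<open>Algebraic extensions of \<open>F\<close> (the type \<open>'a\<close>) are taken inside the algebraic closure of
  \<open>F\<close>, into which \<open>F\<close> embeds by \<^const>\<open>to_ac\<close>. Every algebraic extension of \<open>F\<close> is
  \<open>F\<close>-isomorphic to such a subfield.\<close>

definition adjoin :: "'a :: field alg_closure \<Rightarrow> 'a alg_closure set" where
  "adjoin s = range (\<lambda>p :: 'a poly. poly (map_poly to_ac p) s)"

definition inseparable_quadratic_ext :: "'a :: field alg_closure set \<Rightarrow> bool" where
  "inseparable_quadratic_ext K \<longleftrightarrow>
     (\<exists>\<gamma> :: 'a. \<exists>s. \<gamma> \<noteq> 0 \<and> (\<nexists>x. \<gamma> = x\<^sup>2) \<and> s\<^sup>2 = to_ac \<gamma> \<and> K = adjoin s)"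

definition isotropic_over :: "'b :: field set \<Rightarrow> 'b mat \<Rightarrow> bool" where
  "isotropic_over K A \<longleftrightarrow>
     (\<exists>x \<in> carrier_vec (dim_row A). x \<noteq> 0\<^sub>v (dim_row A) \<and> (\<forall>i < dim_row A. x $ i \<in> K)
        \<and> qf_eval A x = 0)"

definition splitting_field :: "'a :: field alg_closure set \<Rightarrow> 'a mat \<Rightarrow> bool" where
  "splitting_field K A \<longleftrightarrow> isotropic_over K (map_mat to_ac A)"


section \<open>Discrete rank \<open>n\<close> valuations\<close>

text \<open>The value at \<open>0\<close>, conventionally \<open>\<infinity>\<close>, is left unconstrained and never used.\<close>

definition krull_valuation :: "('a :: field \<Rightarrow> 'g :: linordered_ab_group_add) \<Rightarrow> bool" where
  "krull_valuation v \<longleftrightarrow>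
     (\<forall>x y. x \<noteq> 0 \<longrightarrow> y \<noteq> 0 \<longrightarrow> v (x * y) = v x + v y) \<and>
     (\<forall>x y. x \<noteq> 0 \<longrightarrow> y \<noteq> 0 \<longrightarrow> x + y \<noteq> 0 \<longrightarrow> min (v x) (v y) \<le> v (x + y))"

definition value_group :: "('a :: field \<Rightarrow> 'g :: linordered_ab_group_add) \<Rightarrow> 'g set" where
  "value_group v = v ` (UNIV - {0})"

definition convex_subgroup :: "'g :: linordered_ab_group_add set \<Rightarrow> 'g set \<Rightarrow> bool" where
  "convex_subgroup G H \<longleftrightarrow> H \<subseteq> G \<and> 0 \<in> H \<and> (\<forall>x\<in>H. \<forall>y\<in>H. x - y \<in> H) \<and>
     (\<forall>x\<in>H. \<forall>y\<in>G. 0 \<le> y \<longrightarrow> y \<le> x \<longrightarrow> y \<in> H)"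

text \<open>The rank of an ordered abelian group is the number of its convex subgroups other than
  the group itself; the finiteness clause excludes groups of infinite rank when \<open>n = 0\<close>.\<close>

definition has_rank :: "'g :: linordered_ab_group_add set \<Rightarrow> nat \<Rightarrow> bool" where
  "has_rank G n \<longleftrightarrow> finite {H. convex_subgroup G H \<and> H \<noteq> G} \<and>
     card {H. convex_subgroup G H \<and> H \<noteq> G} = n"

definition lex_less :: "int vec \<Rightarrow> int vec \<Rightarrow> bool" where
  "lex_less u w \<longleftrightarrow> (\<exists>i < dim_vec u. u $ i < w $ i \<and> (\<forall>j < i. u $ j = w $ j))"

definition iso_lex_int :: "'g :: linordered_ab_group_add set \<Rightarrow> nat \<Rightarrow> bool" where
  "iso_lex_int G n \<longleftrightarrow>
     (\<exists>f. bij_betw f G (carrier_vec n) \<and>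
          (\<forall>x\<in>G. \<forall>y\<in>G. f (x + y) = f x + f y) \<and>
          (\<forall>x\<in>G. \<forall>y\<in>G. x < y \<longleftrightarrow> lex_less (f x) (f y)))"

definition discrete_rank_valuation ::
  "nat \<Rightarrow> ('a :: field \<Rightarrow> 'g :: linordered_ab_group_add) \<Rightarrow> bool" where
  "discrete_rank_valuation n v \<longleftrightarrow>
     krull_valuation v \<and> has_rank (value_group v) n \<and> iso_lex_int (value_group v) n"

end

theory Submission
  imports Defs
begin

text \<open>
  Identify the value group \<open>\<Gamma>\<close> with \<open>\<int>\<^sup>n\<close> and let the parity of a nonzero element be the
  class of its value in \<open>\<Gamma> / 2\<Gamma>\<close>, encoded as the set of coordinates at which the value is
  odd. There are \<open>2\<^sup>n - 1\<close> nonzero classes, and each nonzero class \<open>D\<close> receives one Pfister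
  form \<open>\<phi>\<^sub>D = \<langle>\<langle>\<beta>\<^sub>1, \<dots>, \<beta>\<^bsub>n-1\<^esub>, \<alpha>]]\<close>: the element \<open>\<alpha>\<close> has parity \<open>D\<close> and \<^emph>\<open>negative\<close>
  value, and the parities of the \<open>\<beta>\<^sub>i\<close> complete \<open>D\<close> to a basis of \<open>\<Gamma> / 2\<Gamma>\<close>. Hence the
  \<open>2\<^sup>n\<close> coefficients \<open>c\<close> and \<open>c\<alpha>\<close> of the squares in \<open>\<phi>\<^sub>D\<close> have pairwise different parities.
  As \<open>\<alpha>\<close> has negative value, a cross term \<open>cuw\<close> has larger value than the smaller of
  \<open>cu\<^sup>2\<close> and \<open>c\<alpha>w\<^sup>2\<close>, so the value of \<open>\<phi>\<^sub>D\<close> at a nonzero vector is that of a unique leading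
  square (\<open>leading_square\<close>).

  Now let \<open>K = F(\<surd>\<gamma>)\<close>. The squares of elements of \<open>K\<close> are the elements \<open>a\<^sup>2 + \<gamma>b\<^sup>2\<close> of \<open>F\<close>.

  If all nonzero ones among them have even value, the valuation extends to \<open>K\<close> without
  enlarging the value group, and the leading square argument applies over \<open>K\<close>: no \<open>\<phi>\<^sub>D\<close>
  becomes isotropic (\<open>anisotropic_over_unramified_sqrt\<close>). The extended valuation is never
  constructed; the equation \<open>\<phi>\<^sub>D(z) = 0\<close> is squared, which by additivity of squaring turns
  it into an equation over \<open>F\<close> in the elements \<open>z\<^sub>k\<^sup>2\<close>.

  Otherwise some \<open>\<delta> = a\<^sup>2 + \<gamma>b\<^sup>2\<close> has nonzero parity, say \<open>D\<close>, and then \<open>K = F(\<surd>\<delta>)\<close>. An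
  isotropic vector \<open>x + \<surd>\<delta> y\<close> of \<open>\<phi>\<^sub>D\<close> would satisfy \<open>\<phi>\<^sub>D(x) = \<delta> \<phi>\<^sub>D(y)\<close> and \<open>B(x, y) = 0\<close>,
  with \<open>B\<close> the polar form. The first equation forces the leading squares of \<open>x\<close> and \<open>y\<close> to
  have parities differing by \<open>D\<close>, the parity of \<open>\<alpha>\<close>, so that they belong to the two
  coordinates of a single binary summand \<open>c[1, \<alpha>]\<close>. The product of these two coordinates
  is then the unique term of least value in \<open>B(x, y)\<close>, which contradicts the second
  equation (\<open>polar_value_nonzero\<close>). So \<open>\<phi>\<^sub>D\<close> is not split by \<open>K\<close>
  (\<open>anisotropic_over_ramified_sqrt\<close>).
\<close>

section \<open>Valuations and dominant terms\<close>

locale krull_valued =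
  fixes v :: "'a :: field \<Rightarrow> 'g :: linordered_ab_group_add"
  assumes krull: "krull_valuation v"
begin

lemma v_mult: "x \<noteq> 0 \<Longrightarrow> y \<noteq> 0 \<Longrightarrow> v (x * y) = v x + v y"
  using krull by (auto simp: krull_valuation_def)

lemma v_add: "x \<noteq> 0 \<Longrightarrow> y \<noteq> 0 \<Longrightarrow> x + y \<noteq> 0 \<Longrightarrow> min (v x) (v y) \<le> v (x + y)"
  using krull by (auto simp: krull_valuation_def)

lemma v_one: "v 1 = 0"
  using v_mult[of 1 1] by simp

lemma v_power2: "x \<noteq> 0 \<Longrightarrow> v (x\<^sup>2) = v x + v x"
  by (simp add: power2_eq_square v_mult)

lemma v_minus: "v (- x) = v x"
proof (cases "x = 0")
  case False
  have "v (- 1) + v (- 1) = 0"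
    using v_mult[of "- 1" "- 1"] v_one by simp
  then have "v (- 1) = 0"
    by simp
  with v_mult[of "- 1" x] False show ?thesis by simp
qed simp

text \<open>Containing \<open>0\<close> explicitly makes this set an additive group although the value of \<open>0\<close>
  is arbitrary.\<close>

definition above :: "'g \<Rightarrow> 'a set" where
  "above g = {x. x = 0 \<or> g < v x}"

lemma above_add:
  assumes "x \<in> above g" "y \<in> above g"
  shows "x + y \<in> above g"
proof (cases "x = 0 \<or> y = 0 \<or> x + y = 0")
  case True
  with assms show ?thesis by (auto simp: above_def)
next
  case False
  with v_add[of x y] assms show ?thesis
    by (auto simp: above_def min_def split: if_splits)
qed

lemma above_sum: "(\<And>a. a \<in> A \<Longrightarrow> f a \<in> above g) \<Longrightarrow> sum f A \<in> above g"
  by (induction A rule: infinite_finite_induct) (simp_all add: above_add, simp_all add: above_def)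

text \<open>If the value of \<open>x + y\<close> were larger than that of \<open>x\<close>, then so would be the value of
  \<open>x = (x + y) - y\<close>.\<close>

lemma dominant_add:
  assumes x: "x \<noteq> 0" and y: "y \<in> above (v x)"
  shows "x + y \<noteq> 0" and "v (x + y) = v x"
proof -
  show nz: "x + y \<noteq> 0"
    using x y v_minus[of x] by (auto simp: above_def add_eq_0_iff)
  show "v (x + y) = v x"
  proof (rule antisym)
    have "\<not> v x < v (x + y)"
    proof
      assume "v x < v (x + y)"
      then have "(x + y) + (- y) \<in> above (v x)"
        using y v_minus[of y] by (intro above_add[of "x + y"]) (auto simp: above_def)
      then show False using x by (auto simp: above_def)
    qed
    then show "v (x + y) \<le> v x" by simp
    show "v x \<le> v (x + y)"
      using v_add[OF x _ nz] y by (cases "y = 0") (auto simp: above_def)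
  qed
qed

end

lemma double_less_cancel: "x + x < y + y \<longleftrightarrow> x < (y :: 'g :: linordered_ab_group_add)"
  by (metis add_mono add_strict_mono linorder_not_less)

lemma double_eq_cancel: "x + x = y + y \<longleftrightarrow> x = (y :: 'g :: linordered_ab_group_add)"
  by (metis add_strict_mono less_irrefl linorder_neqE)

section \<open>Pfister forms in coordinates\<close>

text \<open>The form \<open>c\<^sub>1[1, \<alpha>] \<perp> c\<^sub>2[1, \<alpha>] \<perp> \<dots>\<close> at the vector whose coordinates in the
  \<open>i\<close>-th binary summand are \<open>z (i, False)\<close> and \<open>z (i, True)\<close>. Indexing by pairs makes the
  passage to the other coordinate of the same summand a negation.\<close>

definition pfister_value :: "('i \<Rightarrow> 'a :: comm_ring_1) \<Rightarrow> 'a \<Rightarrow> 'i set \<Rightarrow> ('i \<times> bool \<Rightarrow> 'a) \<Rightarrow> 'a" where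
  "pfister_value c \<alpha> I z =
     (\<Sum>i\<in>I. c i * ((z (i, False))\<^sup>2 + z (i, False) * z (i, True) + \<alpha> * (z (i, True))\<^sup>2))"

definition polar_value ::
  "('i \<Rightarrow> 'a :: comm_ring_1) \<Rightarrow> 'i set \<Rightarrow> ('i \<times> bool \<Rightarrow> 'a) \<Rightarrow> ('i \<times> bool \<Rightarrow> 'a) \<Rightarrow> 'a" where
  "polar_value c I x y =
     (\<Sum>i\<in>I. c i * (x (i, False) * y (i, True) + x (i, True) * y (i, False)))"

definition square_coeff :: "('i \<Rightarrow> 'a :: comm_ring_1) \<Rightarrow> 'a \<Rightarrow> 'i \<times> bool \<Rightarrow> 'a" where
  "square_coeff c \<alpha> k = c (fst k) * (if snd k then \<alpha> else 1)"

lemma sum_times_bool: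
  "(\<Sum>k\<in>I \<times> (UNIV :: bool set). f k) = (\<Sum>i\<in>I. f (i, False) + f (i, True))"
  by (simp add: sum.cartesian_product' UNIV_bool)

lemma pfister_value_split:
  "pfister_value c \<alpha> I z =
    (\<Sum>k\<in>I \<times> UNIV. square_coeff c \<alpha> k * (z k)\<^sup>2) + (\<Sum>i\<in>I. c i * (z (i, False) * z (i, True)))"
  by (simp add: pfister_value_def sum_times_bool square_coeff_def sum.distrib[symmetric] algebra_simps)

lemma polar_value_split:
  "polar_value c I x y = (\<Sum>k\<in>I \<times> UNIV. c (fst k) * (x k * y (fst k, \<not> snd k)))"
  by (simp add: polar_value_def sum_times_bool algebra_simps)

context krull_valued
begin

text \<open>Up to squares of coordinates this is the identity \<open>c\<^sup>2 \<alpha> = c \<cdot> c\<alpha>\<close>: the value of a product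
  of coordinates from one binary summand is the mean of the values of the two corresponding
  squares, increased by \<open>-v(\<alpha>)/2\<close>. The factors \<open>x\<close> and \<open>y\<close> may come from different vectors, so
  it serves both for the form and for its polar form.\<close>

lemma cross_term_value:
  assumes "c i \<noteq> 0" "\<alpha> \<noteq> 0" "x \<noteq> 0" "y \<noteq> 0"
  shows "v (c i * (x * y)) + v (c i * (x * y)) + v \<alpha> =
    v (square_coeff c \<alpha> (i, b) * x\<^sup>2) + v (square_coeff c \<alpha> (i, \<not> b) * y\<^sup>2)"
  using assms by (cases b) (auto simp: square_coeff_def v_mult v_power2 algebra_simps)

text \<open>Among the squares there is a unique one of least value, because their values are
  different. By \<open>cross_term_value\<close> a cross term has larger value than the mean of two squares, hence
  larger than that least value, and cannot interfere.\<close>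

lemma leading_square:
  assumes fin: "finite I" and c: "\<And>i. i \<in> I \<Longrightarrow> c i \<noteq> 0" and \<alpha>: "\<alpha> \<noteq> 0" "v \<alpha> < 0"
    and dist: "\<And>k l. k \<in> I \<times> UNIV \<Longrightarrow> l \<in> I \<times> UNIV \<Longrightarrow> z k \<noteq> 0 \<Longrightarrow> z l \<noteq> 0 \<Longrightarrow>
      v (square_coeff c \<alpha> k * (z k)\<^sup>2) = v (square_coeff c \<alpha> l * (z l)\<^sup>2) \<Longrightarrow> k = l"
    and nz: "\<exists>k\<in>I \<times> UNIV. z k \<noteq> 0"
  obtains k where "k \<in> I \<times> UNIV" "z k \<noteq> 0"
    "\<And>l. l \<in> I \<times> UNIV \<Longrightarrow> l \<noteq> k \<Longrightarrow> z l \<noteq> 0 \<Longrightarrow>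
      v (square_coeff c \<alpha> k * (z k)\<^sup>2) < v (square_coeff c \<alpha> l * (z l)\<^sup>2)"
    "pfister_value c \<alpha> I z \<noteq> 0"
    "v (pfister_value c \<alpha> I z) = v (square_coeff c \<alpha> k * (z k)\<^sup>2)"
proof -
  define m where "m k = square_coeff c \<alpha> k * (z k)\<^sup>2" for k
  define K where "K = {k \<in> I \<times> UNIV. z k \<noteq> 0}"
  have K: "finite K" "K \<noteq> {}"
    using fin nz by (auto simp: K_def)
  obtain k where k: "k \<in> K" and min: "\<And>l. l \<in> K \<Longrightarrow> v (m k) \<le> v (m l)"
    using ex_is_arg_min_if_finite[OF K, of "\<lambda>k. v (m k)"]
    by (auto simp: is_arg_min_linorder)
  have lt: "v (m k) < v (m l)" if "l \<in> K" "l \<noteq> k" for l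
    using min[OF that(1)] dist[of k l] that k by (fastforce simp: K_def m_def)
  have mk: "m k \<noteq> 0"
    using k c \<alpha> by (auto simp: K_def m_def square_coeff_def)
  have sq: "(\<Sum>l\<in>I \<times> UNIV - {k}. m l) \<in> above (v (m k))"
  proof (rule above_sum)
    fix l assume l: "l \<in> I \<times> UNIV - {k}"
    show "m l \<in> above (v (m k))"
    proof (cases "z l = 0")
      case False
      with l lt[of l] show ?thesis by (auto simp: above_def K_def)
    qed (simp add: m_def above_def)
  qed
  have cross: "(\<Sum>i\<in>I. c i * (z (i, False) * z (i, True))) \<in> above (v (m k))"
  proof (rule above_sum)
    fix i assume i: "i \<in> I"
    show "c i * (z (i, False) * z (i, True)) \<in> above (v (m k))"
    proof (cases "z (i, False) = 0 \<or> z (i, True) = 0")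
      case False
      let ?w = "v (c i * (z (i, False) * z (i, True)))"
      from False i have "v (m k) + v (m k) \<le> v (m (i, False)) + v (m (i, True))"
        by (intro add_mono min) (auto simp: K_def)
      also have "\<dots> = ?w + ?w + v \<alpha>"
        using cross_term_value[where b = False and c = c and i = i and \<alpha> = \<alpha>] c[OF i] \<alpha> False
        by (simp add: m_def)
      also have "\<dots> < ?w + ?w" using \<alpha> by simp
      finally show ?thesis by (simp add: double_less_cancel above_def)
    qed (auto simp: above_def)
  qed
  have "pfister_value c \<alpha> I z = m k + ((\<Sum>l\<in>I \<times> UNIV - {k}. m l)
      + (\<Sum>i\<in>I. c i * (z (i, False) * z (i, True))))"
    unfolding pfister_value_split m_def[symmetric]
    using k fin by (subst sum.remove[of _ k]) (auto simp: K_def algebra_simps)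
  with dominant_add[OF mk above_add[OF sq cross]]
  have "pfister_value c \<alpha> I z \<noteq> 0" "v (pfister_value c \<alpha> I z) = v (m k)" by simp_all
  with k lt show thesis by (intro that[of k]) (auto simp: K_def m_def)
qed

end

section \<open>Parity of values\<close>

text \<open>The parity map stands for the homomorphism from \<open>F\<^sup>\<times>\<close> to \<open>\<Gamma> / 2\<Gamma>\<close>; subsets of
  \<open>\<nat>\<close> with symmetric difference form the vector space over the field with two elements in
  which it takes its values.\<close>

locale parity_valued = krull_valued v
  for v :: "'a :: field \<Rightarrow> 'g :: linordered_ab_group_add" +
  fixes par :: "'a \<Rightarrow> nat set"
  assumes par_cong: "x \<noteq> 0 \<Longrightarrow> y \<noteq> 0 \<Longrightarrow> v x = v y \<Longrightarrow> par x = par y"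
    and par_mult: "x \<noteq> 0 \<Longrightarrow> y \<noteq> 0 \<Longrightarrow> par (x * y) = sym_diff (par x) (par y)"
begin

lemma par_power2: "x \<noteq> 0 \<Longrightarrow> par (x\<^sup>2) = {}"
  by (simp add: power2_eq_square par_mult)

lemma par_one: "par 1 = {}"
  using par_power2[of 1] by simp

lemma par_mult_power2: "x \<noteq> 0 \<Longrightarrow> y \<noteq> 0 \<Longrightarrow> par (x * y\<^sup>2) = par x"
  by (simp add: par_mult par_power2)

text \<open>The vector \<open>z\<close> is meant to consist of the squares of the coordinates of an isotropic
  vector over the quadratic extension, and the form with squared coefficients is what
  squaring turns the given form into. Its square terms are \<open>(e\<^sub>k z\<^sub>k)\<^sup>2\<close> with \<open>e\<^sub>k\<close> the given
  coefficients. If two of them had the same value, then halving it would show that their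
  coefficients have the same parity. So \<open>leading_square\<close> applies.\<close>

lemma even_coordinates_zero:
  assumes fin: "finite I" and c: "\<And>i. i \<in> I \<Longrightarrow> c i \<noteq> 0" and \<alpha>: "\<alpha> \<noteq> 0" "v \<alpha> < 0"
    and inj: "inj_on (\<lambda>k. par (square_coeff c \<alpha> k)) (I \<times> UNIV)"
    and even: "\<And>k. k \<in> I \<times> UNIV \<Longrightarrow> z k \<noteq> 0 \<Longrightarrow> par (z k) = {}"
    and zero: "pfister_value (\<lambda>i. (c i)\<^sup>2) (\<alpha>\<^sup>2) I z = 0"
    and k: "k \<in> I \<times> UNIV"
  shows "z k = 0"
proof (rule ccontr)
  assume "z k \<noteq> 0"
  have e: "square_coeff (\<lambda>i. (c i)\<^sup>2) (\<alpha>\<^sup>2) k = (square_coeff c \<alpha> k)\<^sup>2" for k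
    by (simp add: square_coeff_def power_mult_distrib)
  have e0: "square_coeff c \<alpha> k \<noteq> 0" if "k \<in> I \<times> UNIV" for k
    using that c \<alpha> by (auto simp: square_coeff_def)
  have dist: "k = l" if kl: "k \<in> I \<times> UNIV" "l \<in> I \<times> UNIV" and nz: "z k \<noteq> 0" "z l \<noteq> 0"
    and eq: "v (square_coeff (\<lambda>i. (c i)\<^sup>2) (\<alpha>\<^sup>2) k * (z k)\<^sup>2) =
      v (square_coeff (\<lambda>i. (c i)\<^sup>2) (\<alpha>\<^sup>2) l * (z l)\<^sup>2)" for k l
  proof -
    note nz' = e0[OF kl(1)] e0[OF kl(2)] nz
    have "v (square_coeff c \<alpha> k * z k) = v (square_coeff c \<alpha> l * z l)"
      using eq nz' unfolding e power_mult_distrib[symmetric]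
      by (simp add: v_power2 double_eq_cancel)
    then have "par (square_coeff c \<alpha> k * z k) = par (square_coeff c \<alpha> l * z l)"
      using nz' by (intro par_cong) auto
    then have "par (square_coeff c \<alpha> k) = par (square_coeff c \<alpha> l)"
      using nz' even kl by (simp add: par_mult)
    with inj kl show ?thesis by (auto dest: inj_onD)
  qed
  have c2: "(c i)\<^sup>2 \<noteq> 0" if "i \<in> I" for i using c[OF that] by simp
  have \<alpha>2: "\<alpha>\<^sup>2 \<noteq> 0" "v (\<alpha>\<^sup>2) < 0"
    using \<alpha> by (simp_all add: v_power2 add_neg_neg)
  have "\<exists>k\<in>I \<times> UNIV. z k \<noteq> 0" using k \<open>z k \<noteq> 0\<close> by blast
  from leading_square[where c = "\<lambda>i. (c i)\<^sup>2", OF fin c2 \<alpha>2 dist this]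
  have "pfister_value (\<lambda>i. (c i)\<^sup>2) (\<alpha>\<^sup>2) I z \<noteq> 0" by blast
  with zero show False by contradiction
qed

text \<open>With \<open>e\<^sub>k x\<^sub>k\<^sup>2\<close> and \<open>e\<^sub>l y\<^sub>l\<^sup>2\<close> the leading squares of the two vectors, the equation gives
  the parity of \<open>e\<^sub>k\<close> as that of \<open>\<alpha> e\<^sub>l\<close>, so \<open>k\<close> and \<open>l\<close> are the two indices of one binary
  summand. The term \<open>c x\<^sub>k y\<^sub>l\<close> of the polar form is then built from both leading squares,
  whereas every other term is built from squares that are not leading, and so has larger
  value by \<open>cross_term_value\<close>.\<close>

lemma polar_value_nonzero:
  assumes fin: "finite I" and c: "\<And>i. i \<in> I \<Longrightarrow> c i \<noteq> 0" and \<alpha>: "\<alpha> \<noteq> 0" "v \<alpha> < 0"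
    and inj: "inj_on (\<lambda>k. par (square_coeff c \<alpha> k)) (I \<times> UNIV)"
    and \<delta>: "\<delta> \<noteq> 0" "par \<delta> = par \<alpha>"
    and eq: "pfister_value c \<alpha> I x + \<delta> * pfister_value c \<alpha> I y = 0"
    and nz: "\<exists>k\<in>I \<times> UNIV. x k \<noteq> 0 \<or> y k \<noteq> 0"
  shows "polar_value c I x y \<noteq> 0"
proof -
  define e where "e = square_coeff c \<alpha>"
  have e0: "e k \<noteq> 0" if "k \<in> I \<times> UNIV" for k
    using that c \<alpha> by (auto simp: square_coeff_def e_def)
  have dist: "k = l" if kl: "k \<in> I \<times> UNIV" "l \<in> I \<times> UNIV" and nz: "z k \<noteq> 0" "z l \<noteq> 0"
    and eq: "v (e k * (z k)\<^sup>2) = v (e l * (z l)\<^sup>2)" for k l and z :: "'b \<times> bool \<Rightarrow> 'a"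
  proof -
    note nz' = e0[OF kl(1)] e0[OF kl(2)] nz
    have "par (e k * (z k)\<^sup>2) = par (e l * (z l)\<^sup>2)"
      using nz' eq by (intro par_cong) auto
    then have "par (e k) = par (e l)"
      using nz' by (simp add: par_mult_power2)
    with inj kl show ?thesis by (auto dest: inj_onD simp: e_def)
  qed
  have lead: "\<exists>k\<in>I \<times> UNIV. z k \<noteq> 0 \<and>
      (\<forall>l\<in>I \<times> UNIV. l \<noteq> k \<longrightarrow> z l \<noteq> 0 \<longrightarrow> v (e k * (z k)\<^sup>2) < v (e l * (z l)\<^sup>2)) \<and>
      pfister_value c \<alpha> I z \<noteq> 0 \<and> v (pfister_value c \<alpha> I z) = v (e k * (z k)\<^sup>2)"
    if nz: "\<exists>k\<in>I \<times> UNIV. z k \<noteq> 0" for z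
  proof (rule leading_square[where c = c and \<alpha> = \<alpha> and I = I and z = z, OF fin c \<alpha> _ nz])
    show "k = l" if "k \<in> I \<times> UNIV" "l \<in> I \<times> UNIV" "z k \<noteq> 0" "z l \<noteq> 0"
      "v (square_coeff c \<alpha> k * (z k)\<^sup>2) = v (square_coeff c \<alpha> l * (z l)\<^sup>2)" for k l
      using dist[OF that(1-4)] that(5) by (simp add: e_def)
  next
    fix k
    assume "k \<in> I \<times> UNIV" "z k \<noteq> 0"
      "\<And>l. l \<in> I \<times> UNIV \<Longrightarrow> l \<noteq> k \<Longrightarrow> z l \<noteq> 0 \<Longrightarrow>
        v (square_coeff c \<alpha> k * (z k)\<^sup>2) < v (square_coeff c \<alpha> l * (z l)\<^sup>2)"
      "pfister_value c \<alpha> I z \<noteq> 0"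
      "v (pfister_value c \<alpha> I z) = v (square_coeff c \<alpha> k * (z k)\<^sup>2)"
    then show ?thesis
      unfolding e_def by (intro bexI[of _ k] conjI ballI impI)
  qed
  have zero: "pfister_value c \<alpha> I z = 0" if "\<And>k. k \<in> I \<times> UNIV \<Longrightarrow> z k = 0" for z
    using that unfolding pfister_value_def by (intro sum.neutral) auto
  have x: "\<exists>k\<in>I \<times> UNIV. x k \<noteq> 0"
  proof (rule ccontr)
    assume n: "\<not> ?thesis"
    then have "\<exists>k\<in>I \<times> UNIV. y k \<noteq> 0" using nz by blast
    from lead[OF this] have "pfister_value c \<alpha> I y \<noteq> 0" by blast
    with eq zero[of x] n \<delta> show False by auto
  qed
  have y: "\<exists>k\<in>I \<times> UNIV. y k \<noteq> 0"
  proof (rule ccontr)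
    assume n: "\<not> ?thesis"
    from lead[OF x] have "pfister_value c \<alpha> I x \<noteq> 0" by blast
    with eq zero[of y] n show False by auto
  qed
  obtain k where k: "k \<in> I \<times> UNIV" "x k \<noteq> 0"
    "\<And>l. l \<in> I \<times> UNIV \<Longrightarrow> l \<noteq> k \<Longrightarrow> x l \<noteq> 0 \<Longrightarrow> v (e k * (x k)\<^sup>2) < v (e l * (x l)\<^sup>2)"
    "pfister_value c \<alpha> I x \<noteq> 0"
    "v (pfister_value c \<alpha> I x) = v (e k * (x k)\<^sup>2)"
    using lead[OF x] by blast
  obtain l where l: "l \<in> I \<times> UNIV" "y l \<noteq> 0"
    "\<And>j. j \<in> I \<times> UNIV \<Longrightarrow> j \<noteq> l \<Longrightarrow> y j \<noteq> 0 \<Longrightarrow> v (e l * (y l)\<^sup>2) < v (e j * (y j)\<^sup>2)"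
    "pfister_value c \<alpha> I y \<noteq> 0"
    "v (pfister_value c \<alpha> I y) = v (e l * (y l)\<^sup>2)"
    using lead[OF y] by blast
  obtain i b where kib: "k = (i, b)" by (cases k)
  with k have i: "i \<in> I" by auto
  have "par (e k) = sym_diff (par \<alpha>) (par (e l))"
  proof -
    have "pfister_value c \<alpha> I x = - (\<delta> * pfister_value c \<alpha> I y)"
      using eq by (simp add: eq_neg_iff_add_eq_0)
    then have "v (e k * (x k)\<^sup>2) = v (\<delta> * pfister_value c \<alpha> I y)"
      using k(5) by (simp add: v_minus)
    also have "\<dots> = v (\<delta> * (e l * (y l)\<^sup>2))"
      using l(2,4,5) e0[OF l(1)] \<delta> by (simp add: v_mult)
    finally have "par (e k * (x k)\<^sup>2) = par (\<delta> * (e l * (y l)\<^sup>2))"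
      using k(2) l(2) e0[OF k(1)] e0[OF l(1)] \<delta> by (intro par_cong) auto
    then show ?thesis
      using k(2) l(2) e0[OF k(1)] e0[OF l(1)] \<delta> par_mult[of \<delta>] by (simp add: par_mult_power2)
  qed
  also have "\<dots> = par (e (fst l, \<not> snd l))"
    using l(1) c \<alpha> by (cases l; cases "snd l") (auto simp: e_def square_coeff_def par_mult par_one)
  finally have "par (e k) = par (e (fst l, \<not> snd l))" .
  then have "k = (fst l, \<not> snd l)"
    unfolding e_def by (rule inj_onD[OF inj]) (use k(1) l(1) in \<open>auto simp: mem_Times_iff\<close>)
  with kib have lib: "l = (i, \<not> b)" by (cases l) auto
  let ?t = "\<lambda>j. c (fst j) * (x j * y (fst j, \<not> snd j))"
  have tk: "?t k \<noteq> 0" using c[OF i] k(2) l(2) kib lib by simp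
  have vt: "v (?t j) + v (?t j) + v \<alpha> = v (e j * (x j)\<^sup>2) + v (e (fst j, \<not> snd j) * (y (fst j, \<not> snd j))\<^sup>2)"
    if "j \<in> I \<times> UNIV" "x j \<noteq> 0" "y (fst j, \<not> snd j) \<noteq> 0" for j
    using that cross_term_value[of c "fst j" \<alpha> "x j" "y (fst j, \<not> snd j)" "snd j"] c[of "fst j"] \<alpha>
    by (auto simp: e_def)
  have rest: "(\<Sum>j\<in>I \<times> UNIV - {k}. ?t j) \<in> above (v (?t k))"
  proof (rule above_sum)
    fix j assume j: "j \<in> I \<times> UNIV - {k}"
    show "?t j \<in> above (v (?t k))"
    proof (cases "x j = 0 \<or> y (fst j, \<not> snd j) = 0")
      case False
      have "v (e k * (x k)\<^sup>2) < v (e j * (x j)\<^sup>2)" using k(3) j False by blast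
      moreover have "(fst j, \<not> snd j) \<noteq> l" using j kib lib by (cases j) auto
      then have "v (e l * (y l)\<^sup>2) < v (e (fst j, \<not> snd j) * (y (fst j, \<not> snd j))\<^sup>2)"
        using l(3)[of "(fst j, \<not> snd j)"] j False by auto
      ultimately have "v (?t k) + v (?t k) + v \<alpha> < v (?t j) + v (?t j) + v \<alpha>"
        using vt[of j] vt[of k] j k(1,2) l(2) False kib lib by (auto intro: add_strict_mono)
      then show ?thesis by (simp add: above_def double_less_cancel)
    qed (auto simp: above_def)
  qed
  have "polar_value c I x y = ?t k + (\<Sum>j\<in>I \<times> UNIV - {k}. ?t j)"
    unfolding polar_value_split using k(1) fin by (subst sum.remove[of _ k]) auto
  with dominant_add(1)[OF tk rest] show ?thesis by simp
qed

end

section \<open>Pfister forms as matrices\<close>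

lemma qf_eval_smult:
  assumes "A \<in> carrier_mat n n" "x \<in> carrier_vec n"
  shows "qf_eval (c \<cdot>\<^sub>m A) x = c * qf_eval A x"
  using assms by (simp add: qf_eval_def scalar_prod_def sum_distrib_left algebra_simps)

lemma qf_eval_block:
  assumes "A \<in> carrier_mat n n" "B \<in> carrier_mat m m" "x \<in> carrier_vec n" "y \<in> carrier_vec m"
  shows "qf_eval (four_block_mat A (0\<^sub>m n m) (0\<^sub>m m n) B) (x @\<^sub>v y) = qf_eval A x + qf_eval B y"
  unfolding qf_eval_def mult_mat_vec_split[OF assms]
  by (rule scalar_prod_append) (use assms in auto)

lemma binary_form_carrier: "binary_form a b \<in> carrier_mat 2 2"
  by (simp add: binary_form_def mat_of_rows_list_def numeral_2_eq_2)

lemma qf_eval_binary_form_vec: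
  assumes "x \<in> carrier_vec 2"
  shows "qf_eval (binary_form 1 \<alpha>) x = (x $ 0)\<^sup>2 + x $ 0 * x $ 1 + \<alpha> * (x $ 1)\<^sup>2"
proof -
  have "x = vec_of_list [x $ 0, x $ 1]"
    using assms by (intro eq_vecI) (auto simp: numeral_2_eq_2 less_Suc_eq)
  with qf_eval_binary_form[of 1 \<alpha> "x $ 0" "x $ 1"] show ?thesis by simp
qed

lemma diag_tensor_qf_Nil: "diag_tensor_qf [] A = 0\<^sub>m 0 0"
  by (simp add: diag_tensor_qf_def)

lemma diag_tensor_qf_carrier:
  assumes "A \<in> carrier_mat n n"
  shows "diag_tensor_qf cs A \<in> carrier_mat (n * length cs) (n * length cs)"
  using assms unfolding diag_tensor_qf_def
  by (intro carrier_matI; induction cs) (simp_all add: dim_diag_block_mat)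

lemma diag_tensor_qf_Cons:
  assumes "A \<in> carrier_mat n n"
  shows "diag_tensor_qf (c # cs) A =
    four_block_mat (c \<cdot>\<^sub>m A) (0\<^sub>m n (n * length cs)) (0\<^sub>m (n * length cs) n) (diag_tensor_qf cs A)"
  using assms diag_tensor_qf_carrier[OF assms, of cs] by (auto simp: diag_tensor_qf_def Let_def)

lemma qf_eval_diag_tensor:
  assumes "x \<in> carrier_vec (2 * length cs)"
  shows "qf_eval (diag_tensor_qf cs (binary_form 1 \<alpha>)) x =
    pfister_value (\<lambda>i. cs ! i) \<alpha> {..<length cs} (\<lambda>k. x $ (2 * fst k + of_bool (snd k)))"
  using assms
proof (induction cs arbitrary: x)
  case Nil
  then show ?case
    by (simp add: diag_tensor_qf_Nil qf_eval_def scalar_prod_def pfister_value_def)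
next
  case (Cons c cs)
  let ?m = "2 * length cs" and ?A = "binary_form 1 \<alpha>"
  define a where "a = vec_first x 2"
  define d where "d = vec_last x ?m"
  have ad: "a \<in> carrier_vec 2" "d \<in> carrier_vec ?m" by (simp_all add: a_def d_def)
  have x: "x = a @\<^sub>v d"
    using Cons.prems vec_first_last_append[of x 2 ?m] by (simp add: a_def d_def)
  have a: "a $ 0 = x $ 0" "a $ 1 = x $ 1"
    by (simp_all add: a_def vec_first_def)
  have d: "d $ i = x $ Suc (Suc i)" if "i < ?m" for i
    using that Cons.prems by (simp add: d_def vec_last_def)
  have "qf_eval (diag_tensor_qf (c # cs) ?A) x =
      qf_eval (c \<cdot>\<^sub>m ?A) a + qf_eval (diag_tensor_qf cs ?A) d"
    unfolding diag_tensor_qf_Cons[OF binary_form_carrier] x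
    by (rule qf_eval_block) (simp_all add: ad binary_form_carrier diag_tensor_qf_carrier[OF binary_form_carrier])
  also have "qf_eval (c \<cdot>\<^sub>m ?A) a = c * ((x $ 0)\<^sup>2 + x $ 0 * x $ 1 + \<alpha> * (x $ 1)\<^sup>2)"
    using ad a by (simp add: qf_eval_smult[OF binary_form_carrier] qf_eval_binary_form_vec)
  finally show ?case
    using Cons.IH[OF ad(2)] d by (simp add: pfister_value_def sum.lessThan_Suc_shift
        del: sum.lessThan_Suc)
qed

lemma map_mat_to_ac_zero: "map_mat to_ac (0\<^sub>m i j) = 0\<^sub>m i j"
  by (rule eq_matI) auto

lemma map_mat_diag_tensor:
  "map_mat to_ac (diag_tensor_qf cs (binary_form 1 \<alpha>)) =
    diag_tensor_qf (map to_ac cs) (binary_form 1 (to_ac \<alpha>))"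
proof (induction cs)
  case (Cons c cs)
  have 1: "map_mat to_ac (c \<cdot>\<^sub>m binary_form 1 \<alpha>) = to_ac c \<cdot>\<^sub>m binary_form 1 (to_ac \<alpha>)"
    by (rule eq_matI) (auto simp: binary_form_def mat_of_rows_list_def numeral_2_eq_2 less_Suc_eq)
  have "map_mat to_ac (diag_tensor_qf (c # cs) (binary_form 1 \<alpha>)) =
    four_block_mat (map_mat to_ac (c \<cdot>\<^sub>m binary_form 1 \<alpha>)) (map_mat to_ac (0\<^sub>m 2 (2 * length cs)))
      (map_mat to_ac (0\<^sub>m (2 * length cs) 2)) (map_mat to_ac (diag_tensor_qf cs (binary_form 1 \<alpha>)))"
    unfolding diag_tensor_qf_Cons[OF binary_form_carrier]
    by (rule map_four_block_mat[of _ 2 2 _ "2 * length cs" _ "2 * length cs"]) (simp_all add: binary_form_carrier diag_tensor_qf_carrier[OF binary_form_carrier])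
  then show ?case
    by (simp add: 1 map_mat_to_ac_zero Cons.IH diag_tensor_qf_Cons[OF binary_form_carrier])
qed (simp add: diag_tensor_qf_Nil map_mat_to_ac_zero)

lemma bilinear_pfister_Cons:
  "bilinear_pfister (\<beta> # \<beta>s) = bilinear_pfister \<beta>s @ map ((*) \<beta>) (bilinear_pfister \<beta>s)"
  by (simp add: diag_tensor_def map_idI)

lemma bilinear_pfister_hd: "\<exists>cs. bilinear_pfister \<beta>s = 1 # cs"
  by (induction \<beta>s) (auto simp: bilinear_pfister_Cons simp del: bilinear_pfister.simps(2))

text \<open>The form determines the parameter \<open>\<alpha>\<close>, because the bilinear Pfister form starts with the
  entry \<open>1\<close>. This is what tells apart the forms constructed for different classes.\<close>

lemma quadratic_pfister_entry_1_1: "quadratic_pfister \<beta>s \<alpha> $$ (1, 1) = \<alpha>"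
proof -
  obtain cs where "bilinear_pfister \<beta>s = 1 # cs" using bilinear_pfister_hd by blast
  then show ?thesis
    using diag_tensor_qf_carrier[OF binary_form_carrier, of cs 1 \<alpha>] binary_form_carrier[of 1 \<alpha>]
    by (simp add: quadratic_pfister_def diag_tensor_qf_Cons[OF binary_form_carrier])
      (simp add: binary_form_def mat_of_rows_list_def)
qed

section \<open>Anisotropy over inseparable quadratic extensions\<close>

lemma power2_add_char2:
  assumes "(2 :: 'b :: comm_ring_1) = 0"
  shows "(x + y)\<^sup>2 = x\<^sup>2 + (y :: 'b)\<^sup>2"
  by (simp add: power2_sum assms)

lemma power2_sum_char2:
  assumes "(2 :: 'b :: comm_ring_1) = 0"
  shows "(\<Sum>i\<in>I. f i)\<^sup>2 = (\<Sum>i\<in>I. (f i :: 'b)\<^sup>2)"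
  by (induction I rule: infinite_finite_induct) (auto simp: power2_add_char2[OF assms])

lemma pfister_value_power2:
  assumes "(2 :: 'b :: comm_ring_1) = 0"
  shows "(pfister_value c \<alpha> I z)\<^sup>2 =
    pfister_value (\<lambda>i. (c i)\<^sup>2) (\<alpha>\<^sup>2) I (\<lambda>k. (z k :: 'b)\<^sup>2)"
  by (simp add: pfister_value_def power2_sum_char2[OF assms] power2_add_char2[OF assms]
      power_mult_distrib)

lemma pfister_value_add_mult:
  assumes "(2 :: 'b :: comm_ring_1) = 0"
  shows "pfister_value c \<alpha> I (\<lambda>k. x k + t * y k) =
    pfister_value c \<alpha> I x + t\<^sup>2 * pfister_value c \<alpha> I y + t * polar_value c I x (y :: _ \<Rightarrow> 'b)"
  unfolding pfister_value_def polar_value_def power2_add_char2[OF assms] power_mult_distrib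
    sum_distrib_left sum.distrib[symmetric]
  by (intro sum.cong refl) (simp add: algebra_simps power2_eq_square)

lemma pfister_value_to_ac:
  "to_ac (pfister_value c \<alpha> I z) = pfister_value (\<lambda>i. to_ac (c i)) (to_ac \<alpha>) I (\<lambda>k. to_ac (z k))"
  by (simp add: pfister_value_def to_ac_sum)

lemma polar_value_to_ac:
  "to_ac (polar_value c I x y) =
    polar_value (\<lambda>i. to_ac (c i)) I (\<lambda>k. to_ac (x k)) (\<lambda>k. to_ac (y k))"
  by (simp add: polar_value_def to_ac_sum)

lemma adjoin_sqrt:
  assumes "s\<^sup>2 = to_ac \<gamma>" "z \<in> adjoin s"
  obtains a b where "z = to_ac a + to_ac b * s"
proof -
  have "\<exists>a b. poly (map_poly to_ac p) s = to_ac a + to_ac b * s" for p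
  proof (induction p)
    case (pCons a p)
    then obtain x y where xy: "poly (map_poly to_ac p) s = to_ac x + to_ac y * s" by blast
    have "poly (map_poly to_ac (pCons a p)) s = to_ac (a + y * \<gamma>) + to_ac x * s"
      using xy by (simp add: map_poly_pCons algebra_simps assms(1)[symmetric] power2_eq_square)
    then show ?case by blast
  qed (auto intro!: exI[of _ 0])
  moreover obtain p where "z = poly (map_poly to_ac p) s"
    using assms(2) by (auto simp: adjoin_def)
  ultimately show thesis using that by metis
qed

context parity_valued
begin

text \<open>Over an extension whose value group is not enlarged, the squares of all coordinates
  are elements of \<open>F\<close> of even value, so squaring the equation reduces the claim to
  \<open>even_coordinates_zero\<close>.\<close>

lemma anisotropic_over_unramified_sqrt:
  assumes two: "(2 :: 'a) = 0"
    and fin: "finite I" and c: "\<And>i. i \<in> I \<Longrightarrow> c i \<noteq> 0" and \<alpha>: "\<alpha> \<noteq> 0" "v \<alpha> < 0"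
    and inj: "inj_on (\<lambda>k. par (square_coeff c \<alpha> k)) (I \<times> UNIV)"
    and s: "s\<^sup>2 = to_ac \<gamma>"
    and even: "\<And>a b. a\<^sup>2 + \<gamma> * b\<^sup>2 \<noteq> 0 \<Longrightarrow> par (a\<^sup>2 + \<gamma> * b\<^sup>2) = {}"
    and z: "\<And>k. k \<in> I \<times> UNIV \<Longrightarrow> z k \<in> adjoin s"
    and zero: "pfister_value (\<lambda>i. to_ac (c i)) (to_ac \<alpha>) I z = 0"
    and k: "k \<in> I \<times> UNIV"
  shows "z k = 0"
proof -
  have two': "(2 :: 'a alg_closure) = 0"
    using arg_cong[OF two, of to_ac] by simp
  have "\<exists>a b. z k = to_ac a + to_ac b * s" if "k \<in> I \<times> UNIV" for k
    using adjoin_sqrt[OF s z[OF that]] by metis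
  then obtain a b where ab: "\<And>k. k \<in> I \<times> UNIV \<Longrightarrow> z k = to_ac (a k) + to_ac (b k) * s"
    by metis
  define w where "w k = (a k)\<^sup>2 + \<gamma> * (b k)\<^sup>2" for k
  have zw: "(z k)\<^sup>2 = to_ac (w k)" if "k \<in> I \<times> UNIV" for k
    using ab[OF that] by (simp add: power2_add_char2[OF two'] power_mult_distrib s w_def)
  have "0 = (pfister_value (\<lambda>i. to_ac (c i)) (to_ac \<alpha>) I z)\<^sup>2" using zero by simp
  also have "\<dots> = pfister_value (\<lambda>i. to_ac ((c i)\<^sup>2)) (to_ac (\<alpha>\<^sup>2)) I (\<lambda>k. to_ac (w k))"
    unfolding pfister_value_power2[OF two'] unfolding pfister_value_def
    by (intro sum.cong refl) (simp add: zw)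
  also have "\<dots> = to_ac (pfister_value (\<lambda>i. (c i)\<^sup>2) (\<alpha>\<^sup>2) I w)"
    by (rule pfister_value_to_ac[symmetric])
  finally have "pfister_value (\<lambda>i. (c i)\<^sup>2) (\<alpha>\<^sup>2) I w = 0"
    by simp
  moreover have "par (w k) = {}" if "w k \<noteq> 0" for k
    using that even by (simp add: w_def)
  ultimately have "w k = 0"
    using even_coordinates_zero[where z = w, OF fin c \<alpha> inj _ _ k] by blast
  with zw[OF k] show ?thesis by simp
qed

text \<open>The element \<open>t = a + bs\<close> is a square root of an element of nonzero parity, so it lies
  outside \<open>F\<close> and generates the extension. The equation therefore splits into a component
  in \<open>F\<close> and one in \<open>tF\<close>, and these cannot vanish together by \<open>polar_value_nonzero\<close>.\<close>

lemma anisotropic_over_ramified_sqrt: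
  assumes two: "(2 :: 'a) = 0"
    and fin: "finite I" and c: "\<And>i. i \<in> I \<Longrightarrow> c i \<noteq> 0" and \<alpha>: "\<alpha> \<noteq> 0" "v \<alpha> < 0"
    and inj: "inj_on (\<lambda>k. par (square_coeff c \<alpha> k)) (I \<times> UNIV)"
    and s: "s\<^sup>2 = to_ac \<gamma>"
    and \<delta>: "a\<^sup>2 + \<gamma> * b\<^sup>2 \<noteq> 0" "par (a\<^sup>2 + \<gamma> * b\<^sup>2) = par \<alpha>" "par \<alpha> \<noteq> {}"
    and z: "\<And>k. k \<in> I \<times> UNIV \<Longrightarrow> z k \<in> adjoin s"
    and zero: "pfister_value (\<lambda>i. to_ac (c i)) (to_ac \<alpha>) I z = 0"
    and k: "k \<in> I \<times> UNIV"
  shows "z k = 0"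
proof (rule ccontr)
  assume nz: "z k \<noteq> 0"
  have two': "(2 :: 'a alg_closure) = 0"
    using arg_cong[OF two, of to_ac] by simp
  define \<delta> where "\<delta> = a\<^sup>2 + \<gamma> * b\<^sup>2"
  define t where "t = to_ac a + to_ac b * s"
  have t2: "t\<^sup>2 = to_ac \<delta>"
    by (simp add: t_def \<delta>_def power2_add_char2[OF two'] power_mult_distrib s)
  have b: "b \<noteq> 0"
  proof
    assume "b = 0"
    with \<delta> par_power2[of a] show False by simp
  qed
  have "\<exists>x y. z k = to_ac x + t * to_ac y" if kI: "k \<in> I \<times> UNIV" for k
  proof -
    obtain x y where "z k = to_ac x + to_ac y * s"
      by (rule adjoin_sqrt[OF s z[OF kI]])
    moreover define q where "q = y / b"
    then have "y = b * q" using b by simp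
    ultimately have "z k = to_ac (x - a * q) + t * to_ac q"
      by (simp add: t_def algebra_simps)
    then show ?thesis by blast
  qed
  then obtain x y where xy: "\<And>k. k \<in> I \<times> UNIV \<Longrightarrow> z k = to_ac (x k) + t * to_ac (y k)"
    by metis
  define P where "P = pfister_value c \<alpha> I x + \<delta> * pfister_value c \<alpha> I y"
  define Q where "Q = polar_value c I x y"
  have "0 = pfister_value (\<lambda>i. to_ac (c i)) (to_ac \<alpha>) I (\<lambda>k. to_ac (x k) + t * to_ac (y k))"
    using zero unfolding pfister_value_def by (simp add: xy)
  also have "\<dots> = to_ac P + t * to_ac Q"
    unfolding pfister_value_add_mult[OF two'] P_def Q_def t2
    by (simp add: pfister_value_to_ac polar_value_to_ac)
  finally have PQ: "to_ac P + t * to_ac Q = 0" by simp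
  have "Q = 0"
  proof (rule ccontr)
    assume "Q \<noteq> 0"
    have "t * to_ac Q = - to_ac P"
      using PQ by (simp add: eq_neg_iff_add_eq_0 add.commute)
    with \<open>Q \<noteq> 0\<close> have "t = - to_ac P / to_ac Q"
      by (metis nonzero_eq_divide_eq to_ac_eq_0_iff)
    then have "t = to_ac (- P / Q)" by simp
    with t2 have "to_ac \<delta> = to_ac ((- P / Q)\<^sup>2)" by (simp only: to_ac_power)
    then have "\<delta> = (- P / Q)\<^sup>2" by (simp only: to_ac_eq_iff)
    with \<delta> par_power2[of "- P / Q"] show False by (auto simp: \<delta>_def[symmetric])
  qed
  moreover have "P = 0" using PQ \<open>Q = 0\<close> by simp
  moreover have "\<exists>k\<in>I \<times> UNIV. x k \<noteq> 0 \<or> y k \<noteq> 0"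
    using nz k xy[OF k] by (intro bexI[of _ k]) auto
  ultimately show False
    using polar_value_nonzero[OF fin c \<alpha> inj \<delta>(1,2)[folded \<delta>_def], of x y]
    unfolding P_def Q_def by blast
qed

text \<open>The entries of the bilinear Pfister form are the products of the subfamilies of
  \<open>b\<close>; their parities run through the subsets of the index set, each once.\<close>

lemma bilinear_pfister_parities:
  assumes "distinct js" "\<And>j. j \<in> set js \<Longrightarrow> b j \<noteq> 0 \<and> par (b j) = {j}"
  shows "distinct (map par (bilinear_pfister (map b js))) \<and>
    (\<forall>c\<in>set (bilinear_pfister (map b js)). c \<noteq> 0 \<and> par c \<subseteq> set js)"
  using assms
proof (induction js)
  case Nil
  then show ?case by (simp add: par_one)
next
  case (Cons j js)
  let ?L = "bilinear_pfister (map b js)"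
  have IH: "distinct (map par ?L)" "\<And>c. c \<in> set ?L \<Longrightarrow> c \<noteq> 0 \<and> par c \<subseteq> set js"
    using Cons by auto
  have bj: "b j \<noteq> 0" "par (b j) = {j}" using Cons.prems by auto
  have j: "j \<notin> set js" using Cons.prems by simp
  let ?M = "map ((*) (b j)) ?L"
  have par: "par (b j * c) = insert j (par c)" if "c \<in> set ?L" for c
    using IH(2)[OF that] bj j par_mult[of "b j" c] by auto
  have notin: "j \<notin> A" if "A \<in> set (map par ?L)" for A
    using that IH(2) j by auto
  have eq: "map par ?M = map (insert j) (map par ?L)"
    using par by simp
  have "inj_on (insert j) (set (map par ?L))"
    by (rule inj_onI) (metis notin insert_ident)
  then have "distinct (map par ?M)"
    unfolding eq distinct_map[of "insert j"] using IH(1) by blast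
  moreover have "set (map par ?L) \<inter> set (map par ?M) = {}"
  proof -
    have "j \<in> A" if "A \<in> set (map par ?M)" for A
      using that par by auto
    with notin show ?thesis by blast
  qed
  ultimately have "distinct (map par (?L @ ?M))"
    using IH(1) by simp
  moreover have "c \<noteq> 0 \<and> par c \<subseteq> set (j # js)" if "c \<in> set (?L @ ?M)" for c
  proof (cases "c \<in> set ?L")
    case True
    with IH(2)[of c] show ?thesis by auto
  next
    case False
    with that obtain d where "d \<in> set ?L" "c = b j * d" by auto
    with IH(2)[of d] bj par[of d] show ?thesis by auto
  qed
  ultimately show ?case
    by (simp only: list.map bilinear_pfister_Cons) blast
qed

text \<open>The index \<open>j\<close> occurs in the parity of \<open>\<alpha>\<close> but in no parity of an entry \<open>c i\<close>. It thus
  tells apart the coefficients with the factor \<open>\<alpha>\<close> from those without it.\<close>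

lemma square_coeff_parities:
  assumes c: "\<And>i. i \<in> I \<Longrightarrow> c i \<noteq> 0 \<and> j \<notin> par (c i)" and \<alpha>: "\<alpha> \<noteq> 0" "j \<in> par \<alpha>"
    and inj: "inj_on (\<lambda>i. par (c i)) I"
  shows "inj_on (\<lambda>k. par (square_coeff c \<alpha> k)) (I \<times> UNIV)"
proof (rule inj_onI)
  fix k l assume kl: "k \<in> I \<times> (UNIV :: bool set)" "l \<in> I \<times> (UNIV :: bool set)"
    and eq: "par (square_coeff c \<alpha> k) = par (square_coeff c \<alpha> l)"
  have p: "par (square_coeff c \<alpha> k) = (if snd k then sym_diff (par (c (fst k))) (par \<alpha>) else par (c (fst k)))"
    if "k \<in> I \<times> UNIV" for k
    using that c[of "fst k"] \<alpha>(1) by (auto simp: square_coeff_def par_mult simp del: Diff_iff)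
  have jk: "j \<in> par (square_coeff c \<alpha> k) \<longleftrightarrow> snd k" if "k \<in> I \<times> UNIV" for k
  proof -
    have "j \<notin> par (c (fst k))" using that c by auto
    with \<alpha>(2) show ?thesis by (cases "snd k") (simp_all add: p[OF that])
  qed
  have "snd k = snd l" using jk[OF kl(1)] jk[OF kl(2)] eq by simp
  moreover have "par (c (fst k)) = par (c (fst l))"
  proof (cases "snd l")
    case True
    then have "sym_diff (par (c (fst k))) (par \<alpha>) = sym_diff (par (c (fst l))) (par \<alpha>)"
      using eq \<open>snd k = snd l\<close> by (simp add: p[OF kl(1)] p[OF kl(2)])
    then show ?thesis by blast
  next
    case False
    then show ?thesis
      using eq \<open>snd k = snd l\<close> by (simp add: p[OF kl(1)] p[OF kl(2)])
  qed
  then have "fst k = fst l"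
    by (rule inj_onD[OF inj]) (use kl in auto)
  ultimately show "k = l" by (simp add: prod_eq_iff)
qed

text \<open>The disjunction on \<open>\<gamma>\<close> says that the extension is unramified, or that it is ramified and
  contains a square root of an element of the parity of \<open>\<alpha>\<close>.\<close>

lemma not_splitting_field:
  assumes two: "(2 :: 'a) = 0"
    and js: "distinct js" "\<And>j. j \<in> set js \<Longrightarrow> b j \<noteq> 0 \<and> par (b j) = {j}"
    and \<alpha>: "\<alpha> \<noteq> 0" "v \<alpha> < 0" "j \<in> par \<alpha>" "j \<notin> set js"
    and s: "s\<^sup>2 = to_ac \<gamma>"
    and \<gamma>: "(\<forall>x y. x\<^sup>2 + \<gamma> * y\<^sup>2 \<noteq> 0 \<longrightarrow> par (x\<^sup>2 + \<gamma> * y\<^sup>2) = {}) \<or>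
      (\<exists>x y. x\<^sup>2 + \<gamma> * y\<^sup>2 \<noteq> 0 \<and> par (x\<^sup>2 + \<gamma> * y\<^sup>2) = par \<alpha>)"
  shows "\<not> splitting_field (adjoin s) (quadratic_pfister (map b js) \<alpha>)"
proof
  assume split: "splitting_field (adjoin s) (quadratic_pfister (map b js) \<alpha>)"
  define L where "L = bilinear_pfister (map b js)"
  define I where "I = {..<length L}"
  have fin: "finite I" by (simp add: I_def)
  have L: "distinct (map par L)" "\<And>c. c \<in> set L \<Longrightarrow> c \<noteq> 0 \<and> par c \<subseteq> set js"
    using bilinear_pfister_parities[OF js] by (auto simp: L_def)
  have c: "L ! i \<noteq> 0" "j \<notin> par (L ! i)" if "i \<in> I" for i
    using that L(2)[of "L ! i"] \<alpha>(4) by (auto simp: I_def)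
  have "inj_on (\<lambda>i. par (L ! i)) I"
    using L(1) by (auto simp: inj_on_def I_def distinct_conv_nth)
  then have inj: "inj_on (\<lambda>k. par (square_coeff ((!) L) \<alpha> k)) (I \<times> UNIV)"
    using c \<alpha> by (intro square_coeff_parities[where j = j]) auto
  let ?M = "diag_tensor_qf (map to_ac L) (binary_form 1 (to_ac \<alpha>))"
  have M: "?M \<in> carrier_mat (2 * length L) (2 * length L)"
    using diag_tensor_qf_carrier[OF binary_form_carrier, of "map to_ac L"] by simp
  obtain x :: "'a alg_closure vec" where x: "x \<in> carrier_vec (2 * length L)" "x \<noteq> 0\<^sub>v (2 * length L)"
      "\<And>i. i < 2 * length L \<Longrightarrow> x $ i \<in> adjoin s" "qf_eval ?M x = 0"
    using split M unfolding splitting_field_def isotropic_over_def quadratic_pfister_def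
      map_mat_diag_tensor L_def[symmetric] by auto
  define z where "z k = x $ (2 * fst k + of_bool (snd k))" for k :: "nat \<times> bool"
  have "pfister_value (\<lambda>i. map to_ac L ! i) (to_ac \<alpha>) I z = 0"
    using qf_eval_diag_tensor[of x "map to_ac L" "to_ac \<alpha>"] x(1,4) by (simp add: z_def[abs_def] I_def)
  then have zero: "pfister_value (\<lambda>i. to_ac (L ! i)) (to_ac \<alpha>) I z = 0"
    by (simp add: pfister_value_def I_def)
  have z: "z k \<in> adjoin s" if "k \<in> I \<times> UNIV" for k
    using that unfolding z_def by (intro x(3)) (auto simp: I_def of_bool_def)
  have "z k = 0" if k: "k \<in> I \<times> UNIV" for k
    using \<gamma>
  proof
    assume "\<forall>x y. x\<^sup>2 + \<gamma> * y\<^sup>2 \<noteq> 0 \<longrightarrow> par (x\<^sup>2 + \<gamma> * y\<^sup>2) = {}"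
    then show ?thesis
      using anisotropic_over_unramified_sqrt[OF two fin c(1) \<alpha>(1,2) inj s _ z zero k] by blast
  next
    assume "\<exists>x y. x\<^sup>2 + \<gamma> * y\<^sup>2 \<noteq> 0 \<and> par (x\<^sup>2 + \<gamma> * y\<^sup>2) = par \<alpha>"
    then obtain a b where "a\<^sup>2 + \<gamma> * b\<^sup>2 \<noteq> 0" "par (a\<^sup>2 + \<gamma> * b\<^sup>2) = par \<alpha>" by blast
    from anisotropic_over_ramified_sqrt[OF two fin c(1) \<alpha>(1,2) inj s this _ z zero k] \<alpha>(3)
    show ?thesis by auto
  qed
  then have "x $ i = 0" if "i < 2 * length L" for i
  proof -
    have "(i div 2, odd i) \<in> I \<times> UNIV" using that by (auto simp: I_def)
    then have "z (i div 2, odd i) = 0" using \<open>\<And>k. k \<in> I \<times> UNIV \<Longrightarrow> z k = 0\<close> by blast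
    moreover have "2 * (i div 2) + of_bool (odd i) = i"
      by (cases "even i") (simp_all add: odd_two_times_div_two_succ)
    ultimately show ?thesis by (simp add: z_def)
  qed
  with x(1) have "x = 0\<^sub>v (2 * length L)" by (intro eq_vecI) auto
  with x(2) show False by contradiction
qed

end

theorem theorem4p5:
  fixes n :: nat
    and v :: "'a :: field \<Rightarrow> 'g :: linordered_ab_group_add"
  assumes "n \<ge> 2"
    and "CHAR('a) = 2"
    and "discrete_rank_valuation n v"
  shows "\<exists>S :: 'a mat set. card S = 2 ^ n - 1 \<and> (\<forall>A\<in>S. is_quadratic_pfister n A) \<and>
           \<not> (\<exists>K. inseparable_quadratic_ext K \<and> (\<forall>A\<in>S. splitting_field K A))"
proof -
  interpret krull_valued v
    using assms(3) by unfold_locales (simp add: discrete_rank_valuation_def)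
  have two: "(2 :: 'a) = 0"
    using of_nat_CHAR[where 'a = 'a] assms(2) by simp
  obtain f where f: "bij_betw f (value_group v) (carrier_vec n)"
    "\<And>x y. x \<in> value_group v \<Longrightarrow> y \<in> value_group v \<Longrightarrow> f (x + y) = f x + f y"
    "\<And>x y. x \<in> value_group v \<Longrightarrow> y \<in> value_group v \<Longrightarrow> x < y \<longleftrightarrow> lex_less (f x) (f y)"
    using assms(3) unfolding discrete_rank_valuation_def iso_lex_int_def by blast
  have G: "v x \<in> value_group v" if "x \<noteq> 0" for x
    using that by (auto simp: value_group_def)
  have fdim: "dim_vec (f (v x)) = n" if "x \<noteq> 0" for x
    using bij_betwE[OF f(1)] G[OF that] by auto
  have surj: "\<exists>x. x \<noteq> 0 \<and> f (v x) = w" if "w \<in> carrier_vec n" for w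
    using f(1) that unfolding bij_betw_def value_group_def by force
  have f1: "f (v 1) $ i = 0" if "i < n" for i
  proof -
    have "f (v 1) = f (v 1) + f (v 1)"
      using f(2)[OF G G, of 1 1] by (simp add: v_one)
    then have "f (v 1) $ i = (f (v 1) + f (v 1)) $ i" by simp
    with that fdim[of 1] show ?thesis by simp
  qed
  define par where "par x = {j. j < n \<and> odd (f (v x) $ j)}" for x
  interpret parity_valued v par
  proof
    show "par x = par y" if "v x = v y" for x y
      using that by (simp add: par_def)
    show "par (x * y) = sym_diff (par x) (par y)" if "x \<noteq> 0" "y \<noteq> 0" for x y
      using that f(2)[OF G G, of x y] fdim by (auto simp: par_def v_mult)
  qed
  have "\<exists>x. x \<noteq> 0 \<and> par x = {j}" if "j < n" for j
  proof -
    obtain x where "x \<noteq> 0" "f (v x) = vec n (\<lambda>i. if i = j then 1 else 0)"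
      using surj[of "vec n (\<lambda>i. if i = j then 1 else 0)"] by auto
    with that show ?thesis by (intro exI[of _ x]) (auto simp: par_def split: if_splits)
  qed
  then obtain b where b: "\<And>j. j < n \<Longrightarrow> b j \<noteq> 0 \<and> par (b j) = {j}" by metis
  have "\<exists>x. x \<noteq> 0 \<and> par x = D \<and> v x < 0" if D: "D \<in> Pow {..<n} - {{}}" for D
  proof -
    (* Coordinates -1 on D give parity D, and the value is negative in the lexicographic order. *)
    let ?w = "vec n (\<lambda>i. if i \<in> D then - 1 else 0 :: int)"
    obtain x where x: "x \<noteq> 0" "f (v x) = ?w"
      using surj[of ?w] by auto
    have "finite D" "D \<noteq> {}" using D finite_subset by auto
    then have Min: "Min D \<in> D" "\<And>i. i < Min D \<Longrightarrow> i \<notin> D" by auto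
    then have "Min D < n" using D by auto
    have "lex_less (f (v x)) (f (v 1))"
      unfolding lex_less_def x(2)
      using Min \<open>Min D < n\<close> by (intro exI[of _ "Min D"]) (auto simp: f1)
    then have "v x < 0"
      using f(3)[OF G G, of x 1] x(1) by (simp add: v_one)
    moreover have "par x = D" using D x by (auto simp: par_def split: if_splits)
    ultimately show ?thesis using x(1) by blast
  qed
  then obtain \<alpha> where \<alpha>:
    "\<And>D. D \<in> Pow {..<n} - {{}} \<Longrightarrow> \<alpha> D \<noteq> 0 \<and> par (\<alpha> D) = D \<and> v (\<alpha> D) < 0"
    by metis
  (* As Min D lies in D, the unit vectors at the other positions complete D to a basis. *)
  define js where "js D = filter (\<lambda>j. j \<noteq> Min D) [0..<n]" for D
  define \<phi> where "\<phi> D = quadratic_pfister (map b (js D)) (\<alpha> D)" for D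
  define S where "S = \<phi> ` (Pow {..<n} - {{}})"
  have Min: "Min D \<in> D" "Min D < n" if "D \<in> Pow {..<n} - {{}}" for D
  proof -
    show "Min D \<in> D" using that finite_subset[of D "{..<n}"] by (intro Min_in) auto
    then show "Min D < n" using that by auto
  qed
  have "inj_on \<phi> (Pow {..<n} - {{}})"
    by (rule inj_onI) (metis \<phi>_def \<alpha> quadratic_pfister_entry_1_1)
  then have card: "card S = 2 ^ n - 1"
    by (simp add: S_def card_image card_Pow)
  have form: "is_quadratic_pfister n (\<phi> D)" if D: "D \<in> Pow {..<n} - {{}}" for D
  proof -
    have "set (js D) = {..<n} - {Min D}" by (auto simp: js_def)
    moreover have "distinct (js D)" by (simp add: js_def)
    ultimately have "length (js D) = n - 1"
      using Min(2)[OF D] distinct_card[of "js D"] by simp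
    moreover have "0 \<notin> set (map b (js D))"
      using b by (force simp: js_def)
    ultimately show ?thesis
      unfolding is_quadratic_pfister_def \<phi>_def using assms(1)
      by (intro exI[of _ "map b (js D)"] exI[of _ "\<alpha> D"]) auto
  qed
  have False if K: "inseparable_quadratic_ext K" "\<forall>A\<in>S. splitting_field K A" for K
  proof -
    obtain \<gamma> s where s: "s\<^sup>2 = to_ac \<gamma>" "K = adjoin s"
      using K(1) by (auto simp: inseparable_quadratic_ext_def)
    have "\<exists>D\<in>Pow {..<n} - {{}}. (\<forall>x y. x\<^sup>2 + \<gamma> * y\<^sup>2 \<noteq> 0 \<longrightarrow> par (x\<^sup>2 + \<gamma> * y\<^sup>2) = {}) \<or>
      (\<exists>x y. x\<^sup>2 + \<gamma> * y\<^sup>2 \<noteq> 0 \<and> par (x\<^sup>2 + \<gamma> * y\<^sup>2) = D)"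
    proof (cases "\<forall>x y. x\<^sup>2 + \<gamma> * y\<^sup>2 \<noteq> 0 \<longrightarrow> par (x\<^sup>2 + \<gamma> * y\<^sup>2) = {}")
      case True
      (* All the forms stay anisotropic in this case; the class {0} is an arbitrary choice. *)
      with assms(1) show ?thesis by (intro bexI[of _ "{0}"]) auto
    next
      case False
      then obtain x y where "x\<^sup>2 + \<gamma> * y\<^sup>2 \<noteq> 0" "par (x\<^sup>2 + \<gamma> * y\<^sup>2) \<noteq> {}" by blast
      moreover have "par (x\<^sup>2 + \<gamma> * y\<^sup>2) \<subseteq> {..<n}" by (auto simp: par_def)
      ultimately show ?thesis by (intro bexI[of _ "par (x\<^sup>2 + \<gamma> * y\<^sup>2)"]) auto
    qed
    then obtain D where D: "D \<in> Pow {..<n} - {{}}"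
      "(\<forall>x y. x\<^sup>2 + \<gamma> * y\<^sup>2 \<noteq> 0 \<longrightarrow> par (x\<^sup>2 + \<gamma> * y\<^sup>2) = {}) \<or>
        (\<exists>x y. x\<^sup>2 + \<gamma> * y\<^sup>2 \<noteq> 0 \<and> par (x\<^sup>2 + \<gamma> * y\<^sup>2) = D)" by blast
    have "\<not> splitting_field (adjoin s) (quadratic_pfister (map b (js D)) (\<alpha> D))"
      using \<alpha>[OF D(1)] Min[OF D(1)] D(2) b
      by (intro not_splitting_field[where j = "Min D" and \<gamma> = \<gamma>, OF two _ _ _ _ _ _ s(1)])
        (auto simp: js_def)
    with K(2) s(2) D(1) show False by (auto simp: S_def \<phi>_def)
  qed
  moreover have "\<forall>A\<in>S. is_quadratic_pfister n A"
    using form by (auto simp: S_def)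
  ultimately show ?thesis using card by blast
qed

end
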